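(* Let $c>1$ be an integer with prime decomposition $c = p_1^{n_1}\cdots p_k^{n_k}$, where $k\ge 1$, $p_1,\ldots,p_k$ are distinct primes and $n_1,\ldots,n_k$ are positive integers. (1) If $p_i \equiv 1 \pmod 4$ for every $i$, then $\operatorname{pt}$ restricts to a bijection from the set $\{\zeta_{p_1}^{n_1}\,\zeta_{p_2}^{\epsilon_2 n_2}\cdots\zeta_{p_k}^{\epsilon_k n_k} \mid \epsilon_2,\ldots,\epsilon_k \in \{\pm1\}\}$ onto $\operatorname{PT}_c$. (2) Otherwise, $\operatorname{PT}_c$ is empty.
   Context: A pythagorean triple is a triple $(a,b,c)$ of positive integers with $a^2+b^2=c^2$; it is normalized if $\gcd(a,b,c)=1$ and $a\le b$. $\operatorname{PT}_c$ is the set of normalized pythagorean triples with third entry (hypotenuse) equal to $c$. Let $G(\mathbb{Q}) = \{ s + t\,i \in \mathbb{C} \mid s,t\in\mathbb{Q},\ s^2+t^2=1\}$ (a group under multiplication) and $U = \{\pm1,\pm i\}$. For $\zeta = s+t\,i \in G(\mathbb{Q})\setminus U$, $\operatorname{pt}(\zeta)$ denotes the unique normalized pythagorean triple $(a,b,c)$ with $a/c = \min(|s|,|t|)$ and $b/c = \max(|s|,|t|)$. For a prime $p\equiv 1 \pmod 4$, write $p=m^2+n^2$ with integers $0<m<n$ (these are unique), set $q=m+n\,i$, $\bar q = m-n\,i$, and $\zeta_p = q/\bar q \in G(\mathbb{Q})$. *)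

theory Defs
  imports "HOL-Analysis.Analysis" "HOL-Number_Theory.Cong"
begin

definition pythagorean_triple :: "nat \<times> nat \<times> nat \<Rightarrow> bool" where
  "pythagorean_triple = (\<lambda>(a, b, c). 0 < a \<and> 0 < b \<and> 0 < c \<and> a\<^sup>2 + b\<^sup>2 = c\<^sup>2)"

definition normalized_triple :: "nat \<times> nat \<times> nat \<Rightarrow> bool" where
  "normalized_triple = (\<lambda>(a, b, c). Gcd {a, b, c} = 1 \<and> a \<le> b)"

definition PT :: "nat \<Rightarrow> (nat \<times> nat \<times> nat) set" where
  "PT c = {(a, b, c') | a b c'.
     pythagorean_triple (a, b, c') \<and> normalized_triple (a, b, c') \<and> c' = c}"

definition GQ :: "complex set" where
  "GQ = {of_real s + of_real t * \<i> | s t :: real. s \<in> \<rat> \<and> t \<in> \<rat> \<and> s\<^sup>2 + t\<^sup>2 = 1}"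

definition U :: "complex set" where
  "U = {1, -1, \<i>, -\<i>}"

(* Meaningful only on GQ - U, where exactly one triple satisfies the description. *)
definition pt :: "complex \<Rightarrow> nat \<times> nat \<times> nat" where
  "pt \<zeta> = (THE (a, b, c).
     pythagorean_triple (a, b, c) \<and> normalized_triple (a, b, c) \<and>
     real a / real c = min \<bar>Re \<zeta>\<bar> \<bar>Im \<zeta>\<bar> \<and>
     real b / real c = max \<bar>Re \<zeta>\<bar> \<bar>Im \<zeta>\<bar>)"

(* Meaningful only for primes p congruent to 1 modulo 4, where the pair (m, n) exists
   and is unique. *)
definition two_squares :: "nat \<Rightarrow> nat \<times> nat" where
  "two_squares p = (THE (m, n). 0 < m \<and> m < n \<and> p = m\<^sup>2 + n\<^sup>2)"

definition zeta :: "nat \<Rightarrow> complex" where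
  "zeta p = (case two_squares p of (m, n) \<Rightarrow>
     let q = of_nat m + of_nat n * \<i> in q / cnj q)"

end

theory Submission
  imports Defs "HOL-Number_Theory.Euler_Criterion" "HOL-Library.Discrete_Functions"
begin

text \<open>
  Multiplying a normalized triple's \<open>\<zeta> = (a + b i) / c\<close> by \<open>c\<close> gives a Gaussian integer of norm
  \<open>c\<^sup>2\<close> that no rational prime divides. If a prime \<open>p = q q'\<close> with \<open>q'\<close> the conjugate of \<open>q\<close> divides
  its norm, then exactly one of \<open>q\<close>, \<open>q'\<close> divides it, and to the full power; hence it is a unit
  times a product of powers \<open>q\<^sub>i\<close> or \<open>q\<^sub>i'\<close> to the \<open>2 n\<^sub>i\<close>, one sign per prime. Since \<open>\<zeta>\<^sub>p = q\<^sup>2 / p\<close>, these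
  products divided by \<open>c\<close> are exactly the listed elements once conjugation is used to normalize the
  first sign. Two of them with the same image under \<open>pt\<close> agree up to a unit and conjugation, and
  the signs can be read off from divisibility by the \<open>q\<^sub>i\<close>.
\<close>

section \<open>Gaussian integers\<close>

text \<open>Kept as a subset of \<open>complex\<close> instead of a separate type, so that
  \<open>cnj\<close>, \<open>cmod\<close> and division apply directly to its elements and to
  \<open>zeta\<close>.\<close>

definition gauss_int :: "complex set" where
  "gauss_int = {z. Re z \<in> \<int> \<and> Im z \<in> \<int>}"

text \<open>Divisibility in Z[i]. The relation \<open>dvd\<close> on \<open>complex\<close> is
  trivial because that type is a field.\<close>

definition gdvd :: "complex \<Rightarrow> complex \<Rightarrow> bool" where
  "gdvd d z \<longleftrightarrow> (\<exists>w\<in>gauss_int. z = d * w)"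

lemma gauss_intE:
  assumes "z \<in> gauss_int"
  obtains x y :: int where "z = Complex (of_int x) (of_int y)"
proof -
  from assms obtain x y where "Re z = of_int x" "Im z = of_int y"
    unfolding gauss_int_def by (auto elim!: Ints_cases)
  then have "z = Complex (of_int x) (of_int y)"
    by (simp add: complex_eq_iff)
  then show thesis by (rule that)
qed

lemma gauss_int_Complex [simp]: "Complex (of_int x) (of_int y) \<in> gauss_int"
  by (simp add: gauss_int_def)

lemma gauss_int_mult [simp, intro]:
  "z \<in> gauss_int \<Longrightarrow> w \<in> gauss_int \<Longrightarrow> z * w \<in> gauss_int"
  by (auto simp: gauss_int_def)

lemma gauss_int_1 [simp]: "1 \<in> gauss_int"
  by (simp add: gauss_int_def)

lemma gauss_int_of_nat [simp]: "of_nat n \<in> gauss_int"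
  by (simp add: gauss_int_def)

lemma gauss_int_cnj [simp]: "cnj z \<in> gauss_int \<longleftrightarrow> z \<in> gauss_int"
  by (simp add: gauss_int_def)

lemma gauss_int_power [simp, intro]: "z \<in> gauss_int \<Longrightarrow> z ^ n \<in> gauss_int"
  by (induction n) auto

lemma gauss_int_prod [intro]:
  "(\<And>i. i \<in> A \<Longrightarrow> f i \<in> gauss_int) \<Longrightarrow> prod f A \<in> gauss_int"
  by (induction A rule: infinite_finite_induct) auto

lemma gauss_int_U [simp]: "u \<in> U \<Longrightarrow> u \<in> gauss_int"
  by (auto simp: U_def gauss_int_def)

lemma gauss_int_norm:
  assumes "z \<in> gauss_int"
  obtains M :: nat where "(cmod z)\<^sup>2 = of_nat M"
proof -
  from assms obtain x y where "z = Complex (of_int x) (of_int y)"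
    by (rule gauss_intE)
  then have "(cmod z)\<^sup>2 = of_nat (nat (x\<^sup>2 + y\<^sup>2))"
    by (simp add: cmod_power2)
  then show thesis by (rule that)
qed

lemma gauss_int_norm_1:
  assumes "z \<in> gauss_int" "cmod z = 1"
  shows "z \<in> U"
proof -
  from assms(1) obtain x y where z: "z = Complex (of_int x) (of_int y)"
    by (rule gauss_intE)
  have "(cmod z)\<^sup>2 = 1" using assms(2) by simp
  then have "of_int (x\<^sup>2 + y\<^sup>2) = (1::real)"
    by (simp add: z cmod_power2)
  then have eq: "x\<^sup>2 + y\<^sup>2 = 1" by linarith
  have "x\<^sup>2 \<le> 1\<^sup>2" "y\<^sup>2 \<le> 1\<^sup>2"
    using eq zero_le_power2[of x] zero_le_power2[of y] unfolding power_one by linarith+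
  then have "\<bar>x\<bar> \<le> 1" "\<bar>y\<bar> \<le> 1"
    using power2_le_iff_abs_le[of 1 x] power2_le_iff_abs_le[of 1 y] by auto
  then have "x \<in> {-1, 0, 1}" "y \<in> {-1, 0, 1}" by auto
  with eq show ?thesis by (auto simp: z U_def complex_eq_iff)
qed

section \<open>Divisibility of Gaussian integers\<close>

lemma gdvd_refl [simp]: "gdvd z z"
  unfolding gdvd_def by (rule bexI[of _ 1]) auto

lemma gdvd_mult: "gdvd d z \<Longrightarrow> w \<in> gauss_int \<Longrightarrow> gdvd d (z * w)"
  unfolding gdvd_def by (auto simp: mult.assoc)

lemma gdvd_mult2: "gdvd d z \<Longrightarrow> w \<in> gauss_int \<Longrightarrow> gdvd d (w * z)"
  using gdvd_mult[of d z w] by (simp add: mult.commute)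

lemma gdvd_cnj_iff: "gdvd (cnj d) z \<longleftrightarrow> gdvd d (cnj z)"
proof
  assume "gdvd (cnj d) z"
  then obtain w where "w \<in> gauss_int" "z = cnj d * w" by (auto simp: gdvd_def)
  then show "gdvd d (cnj z)"
    unfolding gdvd_def by (intro bexI[of _ "cnj w"]) auto
next
  assume "gdvd d (cnj z)"
  then obtain w where "w \<in> gauss_int" "cnj z = d * w" by (auto simp: gdvd_def)
  then show "gdvd (cnj d) z"
    unfolding gdvd_def
    by (intro bexI[of _ "cnj w"]) (auto simp: complex_eq_iff algebra_simps)
qed

lemma gdvd_norm:
  assumes "gdvd d z" "(cmod d)\<^sup>2 = of_nat M" "(cmod z)\<^sup>2 = of_nat N"
  shows "M dvd N"
proof -
  from assms(1) obtain w where w: "w \<in> gauss_int" "z = d * w" by (auto simp: gdvd_def)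
  from w(1) obtain K where "(cmod w)\<^sup>2 = of_nat K" by (rule gauss_int_norm)
  then have "of_nat N = (of_nat (M * K) :: real)"
    using w(2) assms by (simp add: norm_mult power_mult_distrib)
  then show ?thesis by (metis dvd_triv_left of_nat_eq_iff)
qed

lemma gdvd_of_nat_iff:
  assumes "p > 0"
  shows "gdvd (of_nat p) (Complex (of_int x) (of_int y)) \<longleftrightarrow> int p dvd x \<and> int p dvd y"
proof
  assume "gdvd (of_nat p) (Complex (of_int x) (of_int y))"
  then obtain w where w: "w \<in> gauss_int" "Complex (of_int x) (of_int y) = of_nat p * w"
    by (auto simp: gdvd_def)
  from w(1) obtain a b where "w = Complex (of_int a) (of_int b)" by (rule gauss_intE)
  with w(2) have "real_of_int x = of_int (int p * a)" "real_of_int y = of_int (int p * b)"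
    by (simp_all add: complex_eq_iff)
  then have "x = int p * a" "y = int p * b" by (simp_all only: of_int_eq_iff)
  then show "int p dvd x \<and> int p dvd y" by simp
next
  assume "int p dvd x \<and> int p dvd y"
  then obtain a b where "x = int p * a" "y = int p * b" by (auto elim!: dvdE)
  then show "gdvd (of_nat p) (Complex (of_int x) (of_int y))"
    unfolding gdvd_def
    by (intro bexI[of _ "Complex (of_int a) (of_int b)"]) (simp_all add: complex_eq_iff)
qed

text \<open>With \<open>q = m + n i\<close> and \<open>z = x + y i\<close>, the quotient
  \<open>z / q = z * cnj q / p\<close> has numerators \<open>x * m + y * n\<close> and
  \<open>y * m - x * n\<close>. Since \<open>p\<close> is prime, divisibility of the second forces
  divisibility of the first, so one linear form decides everything.\<close>

lemma gdvd_prime_norm_iff: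
  fixes m n x y p :: int
  assumes "prime p" and p: "m\<^sup>2 + n\<^sup>2 = p"
  shows "gdvd (Complex (of_int m) (of_int n)) (Complex (of_int x) (of_int y))
    \<longleftrightarrow> p dvd x * n - y * m"
proof
  assume "gdvd (Complex (of_int m) (of_int n)) (Complex (of_int x) (of_int y))"
  then obtain w where w: "w \<in> gauss_int"
    "Complex (of_int x) (of_int y) = Complex (of_int m) (of_int n) * w"
    by (auto simp: gdvd_def)
  from w(1) obtain a b where "w = Complex (of_int a) (of_int b)" by (rule gauss_intE)
  with w(2) have "real_of_int x = of_int (m * a - n * b)" "real_of_int y = of_int (m * b + n * a)"
    by (simp_all add: complex_eq_iff)
  then have "x = m * a - n * b" "y = m * b + n * a" by (simp_all only: of_int_eq_iff)
  then have "x * n - y * m = p * (- b)"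
    by (simp only: flip: p) (simp add: algebra_simps power2_eq_square)
  then show "p dvd x * n - y * m" by (metis dvd_triv_left)
next
  assume 1: "p dvd x * n - y * m"
  \<comment> \<open>Modulo \<open>p\<close>, \<open>n\<close> times this form equals
    \<open>m\<close> times the known one. Either \<open>n\<close> cancels, or \<open>p\<close>
    divides both \<open>n\<close> and \<open>m\<close>.\<close>
  have 2: "p dvd x * m + y * n"
  proof (cases "p dvd n")
    case True
    then have "p dvd m\<^sup>2"
      by (metis p dvd_add_left_iff dvd_mult dvd_refl power2_eq_square)
    then have "p dvd m" using assms(1) prime_dvd_power by blast
    with True show ?thesis by simp
  next
    case False
    have "n * (x * m + y * n) = m * (x * n - y * m) + y * p"
      by (simp add: algebra_simps power2_eq_square flip: p)
    then have "p dvd n * (x * m + y * n)" using 1 by simp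
    with False assms(1) show ?thesis using prime_dvd_mult_iff by blast
  qed
  from 1 obtain b where b: "x * n - y * m = p * b" by (elim dvdE)
  from 2 obtain a where a: "x * m + y * n = p * a" by (elim dvdE)
  have "p * x = p * (m * a + n * b)"
  proof -
    have "p * (m * a + n * b) = m * (x * m + y * n) + n * (x * n - y * m)"
      unfolding a b by (simp add: algebra_simps)
    also have "\<dots> = p * x" by (simp add: algebra_simps power2_eq_square flip: p)
    finally show ?thesis ..
  qed
  moreover have "p * y = p * (n * a - m * b)"
  proof -
    have "p * (n * a - m * b) = n * (x * m + y * n) - m * (x * n - y * m)"
      unfolding a b by (simp add: algebra_simps)
    also have "\<dots> = p * y" by (simp add: algebra_simps power2_eq_square flip: p)
    finally show ?thesis ..
  qed
  moreover have "p \<noteq> 0" using assms(1) by auto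
  ultimately have "x = m * a + n * b" "y = n * a - m * b" by auto
  then show "gdvd (Complex (of_int m) (of_int n)) (Complex (of_int x) (of_int y))"
    unfolding gdvd_def
    \<comment> \<open>The witness is \<open>z * cnj q / p\<close>; its imaginary part is
      \<open>-b\<close> because \<open>b\<close> was defined from
      \<open>x * n - y * m\<close>.\<close>
    by (intro bexI[of _ "Complex (of_int a) (of_int (-b))"])
       (simp_all add: complex_eq_iff gauss_int_def)
qed

section \<open>Gaussian primes of prime norm\<close>

text \<open>Inert rational primes are left out, as their norm is a square. Primality in the sense of
  Euclid's lemma is derived in \<open>gprime_dvd_mult\<close>.\<close>

definition gprime :: "nat \<Rightarrow> complex \<Rightarrow> bool" where
  "gprime p q \<longleftrightarrow> prime p \<and> q \<in> gauss_int \<and> (cmod q)\<^sup>2 = of_nat p"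

lemma gprimeE:
  assumes "gprime p q"
  obtains m n where "q = Complex (of_int m) (of_int n)" "m\<^sup>2 + n\<^sup>2 = int p" "prime p"
proof -
  from assms have q: "q \<in> gauss_int" "(cmod q)\<^sup>2 = of_nat p" "prime p" by (auto simp: gprime_def)
  from q(1) obtain m n where mn: "q = Complex (of_int m) (of_int n)" by (rule gauss_intE)
  with q(2) have "of_int (m\<^sup>2 + n\<^sup>2) = (of_int (int p) :: real)"
    by (simp add: cmod_power2)
  then have "m\<^sup>2 + n\<^sup>2 = int p" by (simp only: of_int_eq_iff)
  with mn q(3) show thesis by (intro that)
qed

lemma gprime_cnj [simp]: "gprime p (cnj q) \<longleftrightarrow> gprime p q"
  by (simp add: gprime_def)

lemma gprime_gauss_int: "gprime p q \<Longrightarrow> q \<in> gauss_int"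
  by (simp add: gprime_def)

lemma gprime_prime: "gprime p q \<Longrightarrow> prime p"
  by (simp add: gprime_def)

lemma gprime_mult_cnj: "gprime p q \<Longrightarrow> q * cnj q = of_nat p"
  by (simp add: gprime_def flip: complex_norm_square)

text \<open>Euclid's lemma, pulled back from the integers. If
  \<open>L(x + y i) = x * n - y * m\<close> is the form testing divisibility by \<open>q\<close>,
  then \<open>n * L(z * w)\<close> is congruent to \<open>L(z) * L(w)\<close> modulo
  \<open>p\<close>.\<close>

lemma gprime_dvd_mult:
  assumes "gprime p q" "z \<in> gauss_int" "w \<in> gauss_int" "gdvd q (z * w)"
  shows "gdvd q z \<or> gdvd q w"
proof -
  from assms(1) obtain m n where q: "q = Complex (of_int m) (of_int n)" "m\<^sup>2 + n\<^sup>2 = int p" "prime p"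
    by (rule gprimeE)
  from assms(2) obtain x y where z: "z = Complex (of_int x) (of_int y)" by (rule gauss_intE)
  from assms(3) obtain s t where w: "w = Complex (of_int s) (of_int t)" by (rule gauss_intE)
  have p: "prime (int p)" using q by simp
  note iff = gdvd_prime_norm_iff[OF p q(2), folded q(1)]
  have "z * w = Complex (of_int (x * s - y * t)) (of_int (x * t + y * s))"
    by (simp add: z w complex_eq_iff)
  then have "int p dvd (x * s - y * t) * n - (x * t + y * s) * m"
    using assms(4) iff by metis
  then have "int p dvd n * ((x * s - y * t) * n - (x * t + y * s) * m) + y * t * int p"
    by simp
  also have "n * ((x * s - y * t) * n - (x * t + y * s) * m) + y * t * int p
      = (x * n - y * m) * (s * n - t * m)"
    by (simp add: algebra_simps power2_eq_square flip: q(2))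
  finally show ?thesis
    using p by (simp add: iff z w prime_dvd_mult_iff)
qed

lemma gprime_not_dvd_norm_1:
  assumes "gprime p q" "cmod z = 1"
  shows "\<not> gdvd q z"
proof
  assume "gdvd q z"
  then have "p dvd 1"
    using assms by (intro gdvd_norm[of q z]) (auto simp: gprime_def)
  then show False using assms by (auto simp: gprime_def)
qed

lemma gprime_dvd_power:
  assumes "gprime p q" "z \<in> gauss_int" "gdvd q (z ^ n)"
  shows "gdvd q z"
  using assms(3)
proof (induction n)
  case 0
  then show ?case using gprime_not_dvd_norm_1[OF assms(1), of 1] by simp
next
  case (Suc n)
  then show ?case using gprime_dvd_mult[OF assms(1,2), of "z ^ n"] assms(2) by auto
qed

lemma gprime_dvd_prod:
  assumes "gprime p q" "finite A" "\<And>i. i \<in> A \<Longrightarrow> f i \<in> gauss_int" "gdvd q (prod f A)"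
  shows "\<exists>i\<in>A. gdvd q (f i)"
  using assms(2-4)
proof (induction A rule: finite_induct)
  case empty
  then show ?case using gprime_not_dvd_norm_1[OF assms(1), of 1] by simp
next
  case (insert a A)
  then have "gdvd q (f a) \<or> gdvd q (prod f A)"
    by (intro gprime_dvd_mult[OF assms(1)]) auto
  with insert show ?case by auto
qed

text \<open>The prime \<open>q\<close> divides \<open>p\<close>, hence the norm
  \<open>z * cnj z\<close>; Euclid's lemma leaves \<open>z\<close> or \<open>cnj z\<close>, and the
  latter case is conjugated.\<close>

lemma gprime_dvd_of_norm_dvd:
  assumes "gprime p q" "z \<in> gauss_int" "(cmod z)\<^sup>2 = of_nat N" "p dvd N"
  shows "gdvd q z \<or> gdvd (cnj q) z"
proof -
  from assms(4) obtain M where M: "N = p * M" by (elim dvdE)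
  have "z * cnj z = q * (cnj q * of_nat M)"
    using assms(3) M gprime_mult_cnj[OF assms(1)]
    by (simp flip: complex_norm_square mult.assoc)
  moreover have "gdvd q (q * (cnj q * of_nat M))"
    using gprime_gauss_int[OF assms(1)] by (intro gdvd_mult) auto
  ultimately have "gdvd q z \<or> gdvd q (cnj z)"
    using assms by (intro gprime_dvd_mult[OF assms(1)]) auto
  then show ?thesis by (simp add: gdvd_cnj_iff)
qed

text \<open>If \<open>q\<close> divided its conjugate, \<open>p\<close> would divide
  \<open>2 * m * n\<close>, hence both \<open>m\<close> and \<open>n\<close>, and then
  \<open>p\<^sup>2\<close> would divide \<open>p\<close>. The prime 2 is a genuine exception, since
  \<open>1 + i\<close> divides \<open>1 - i\<close>.\<close>

lemma gprime_not_dvd_cnj: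
  assumes "gprime p q" "p \<noteq> 2"
  shows "\<not> gdvd q (cnj q)"
proof
  assume *: "gdvd q (cnj q)"
  from assms(1) obtain m n where q: "q = Complex (of_int m) (of_int n)" "m\<^sup>2 + n\<^sup>2 = int p" "prime p"
    by (rule gprimeE)
  have p: "prime (int p)" using q by simp
  have "cnj q = Complex (of_int m) (of_int (-n))" by (simp add: q complex_eq_iff)
  with * have "int p dvd m * n - (- n) * m"
    using gdvd_prime_norm_iff[OF p q(2)] q(1) by metis
  then have "int p dvd 2 * (m * n)" by (simp add: algebra_simps)
  moreover have "\<not> int p dvd 2"
  proof
    assume "int p dvd 2"
    then have "p dvd 2" by presburger
    then have "p \<le> 2" by (rule dvd_imp_le) auto
    with prime_ge_2_nat[OF q(3)] assms(2) show False by auto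
  qed
  ultimately have "int p dvd m \<or> int p dvd n" using p by (auto simp: prime_dvd_mult_iff)
  then have mn: "int p dvd m" "int p dvd n"
  proof -
    have "int p dvd m \<longleftrightarrow> int p dvd n"
    proof -
      have "int p dvd m\<^sup>2 + n\<^sup>2" using q(2) by simp
      then have "int p dvd m\<^sup>2 \<longleftrightarrow> int p dvd n\<^sup>2"
        by (metis dvd_add_left_iff dvd_add_right_iff)
      then show ?thesis using p by (simp add: prime_dvd_power_iff)
    qed
    with \<open>int p dvd m \<or> int p dvd n\<close> show "int p dvd m" "int p dvd n" by auto
  qed
  then have "(int p)\<^sup>2 dvd m\<^sup>2 + n\<^sup>2" by (intro dvd_add dvd_power_same)
  then have "int p * int p dvd int p * 1" unfolding q(2) by (simp add: power2_eq_square)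
  then have "int p dvd 1" using p by (subst (asm) dvd_mult_cancel_left) auto
  then show False using p by auto
qed

text \<open>Since \<open>cnj q\<close> does not divide \<open>q\<close>, it must divide the cofactor
  of \<open>q\<close> in \<open>z\<close>, so the product \<open>q * cnj q = p\<close> splits
  off.\<close>

lemma gprime_both_dvd:
  assumes "gprime p q" "p \<noteq> 2" "gdvd q z" "gdvd (cnj q) z"
  shows "gdvd (of_nat p) z"
proof -
  from assms(3) obtain w where w: "w \<in> gauss_int" "z = q * w" by (auto simp: gdvd_def)
  have "gdvd (cnj q) q \<or> gdvd (cnj q) w"
    using assms w gprime_gauss_int[OF assms(1)]
    by (intro gprime_dvd_mult[of p]) auto
  moreover have "\<not> gdvd (cnj q) q"
    using gprime_not_dvd_cnj[OF assms(1,2)] by (simp add: gdvd_cnj_iff)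
  ultimately obtain v where v: "v \<in> gauss_int" "w = cnj q * v" by (auto simp: gdvd_def)
  have "z = of_nat p * v"
    by (simp add: w v flip: gprime_mult_cnj[OF assms(1)] mult.assoc)
  with v show ?thesis by (auto simp: gdvd_def)
qed

lemma of_nat_gdvd_imp_gprime_dvd:
  assumes "gprime p q" "gdvd (of_nat p) z"
  shows "gdvd q z"
proof -
  from assms(2) obtain w where w: "w \<in> gauss_int" "z = of_nat p * w" by (auto simp: gdvd_def)
  have "z = q * (cnj q * w)" using gprime_mult_cnj[OF assms(1)] w by (simp flip: mult.assoc)
  with w gprime_gauss_int[OF assms(1)] show ?thesis by (auto simp: gdvd_def)
qed

section \<open>Primitive Gaussian integers\<close>

text \<open>The Gaussian counterpart of the gcd condition on triples, as
  \<open>primitive_Complex_iff\<close> shows.\<close>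

definition primitive :: "complex \<Rightarrow> bool" where
  "primitive z \<longleftrightarrow> z \<in> gauss_int \<and> (\<forall>p. prime p \<longrightarrow> \<not> gdvd (of_nat p) z)"

lemma primitive_divisor:
  "primitive (d * w) \<Longrightarrow> d \<in> gauss_int \<Longrightarrow> w \<in> gauss_int \<Longrightarrow> primitive w"
  unfolding primitive_def using gdvd_mult2 by blast

lemma primitive_Complex_iff:
  "primitive (Complex (of_int x) (of_int y)) \<longleftrightarrow> coprime x y"
proof
  assume *: "primitive (Complex (of_int x) (of_int y))"
  show "coprime x y"
  proof (rule ccontr)
    assume "\<not> coprime x y"
    then have "nat (gcd x y) \<noteq> 1" by (simp add: coprime_iff_gcd_eq_1 nat_eq_iff)
    then obtain p where p: "prime p" "p dvd nat (gcd x y)"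
      using prime_factor_nat by blast
    then have "int p dvd gcd x y" by (simp flip: int_dvd_int_iff)
    then have "gdvd (of_nat p) (Complex (of_int x) (of_int y))"
      using p by (simp add: gdvd_of_nat_iff prime_gt_0_nat)
    with * p show False by (auto simp: primitive_def)
  qed
next
  assume *: "coprime x y"
  show "primitive (Complex (of_int x) (of_int y))"
    unfolding primitive_def
  proof (intro conjI allI impI notI)
    fix p :: nat
    assume p: "prime p" "gdvd (of_nat p) (Complex (of_int x) (of_int y))"
    then have "int p dvd x" "int p dvd y" by (simp_all add: gdvd_of_nat_iff prime_gt_0_nat)
    with * have "is_unit (int p)" by (rule coprime_common_divisor)
    with p show False by auto
  qed simp
qed

text \<open>As long as \<open>p\<close> divides the norm, \<open>r\<close> or \<open>cnj r\<close>
  divides \<open>z\<close>, and \<open>cnj r\<close> is ruled out. Splitting off \<open>r\<close>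
  lowers the power of \<open>p\<close> in the norm by one and keeps the other assumptions
  intact.\<close>

lemma primitive_eq_power_mult:
  assumes "gprime p r" "p \<noteq> 2" "primitive z" "(cmod z)\<^sup>2 = of_nat (p ^ n * M)" "\<not> gdvd (cnj r) z"
  shows "\<exists>w\<in>gauss_int. z = r ^ n * w"
  using assms(3-5)
proof (induction n arbitrary: z)
  case 0
  then show ?case by (auto simp: primitive_def)
next
  case (Suc n)
  have z: "z \<in> gauss_int" using Suc.prems by (simp add: primitive_def)
  have r: "r \<in> gauss_int" using assms(1) by (rule gprime_gauss_int)
  have "gdvd r z"
    using gprime_dvd_of_norm_dvd[OF assms(1) z Suc.prems(2)] Suc.prems(3) by auto
  then obtain w where w: "w \<in> gauss_int" "z = r * w" by (auto simp: gdvd_def)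
  have "primitive w" using primitive_divisor Suc.prems(1) w r by blast
  moreover have "(cmod w)\<^sup>2 = of_nat (p ^ n * M)"
  proof -
    have "of_nat p * (cmod w)\<^sup>2 = of_nat p * of_nat (p ^ n * M)"
      using Suc.prems(2) assms(1) w(2) by (simp add: norm_mult power_mult_distrib gprime_def)
    then show ?thesis using prime_gt_0_nat[OF gprime_prime[OF assms(1)]] by simp
  qed
  moreover have "\<not> gdvd (cnj r) w"
    using Suc.prems(3) w r gdvd_mult2 by blast
  ultimately obtain v where "v \<in> gauss_int" "w = r ^ n * v" using Suc.IH by blast
  then show ?case using w by (intro bexI[of _ v]) auto
qed

text \<open>Every value other than 1 selects the conjugate, so \<open>branch\<close> makes sense for
  arbitrary integer-valued \<open>\<epsilon>\<close>.\<close>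

definition branch :: "('a \<Rightarrow> complex) \<Rightarrow> ('a \<Rightarrow> int) \<Rightarrow> 'a \<Rightarrow> complex" where
  "branch q \<epsilon> i = (if \<epsilon> i = 1 then q i else cnj (q i))"

lemma gprime_branch [simp]: "gprime p (branch q \<epsilon> i) \<longleftrightarrow> gprime p (q i)"
  by (simp add: branch_def)

lemma branch_gauss_int [simp]: "branch q \<epsilon> i \<in> gauss_int \<longleftrightarrow> q i \<in> gauss_int"
  by (simp add: branch_def)

text \<open>Induction over the primes: for each one the full power of a single branch splits off.
  Once all primes are used up, the remaining cofactor has norm 1 and is a unit.\<close>

lemma primitive_factorization:
  assumes "finite A" "\<And>i. i \<in> A \<Longrightarrow> gprime (p i) (q i)" "\<And>i. i \<in> A \<Longrightarrow> p i \<noteq> 2"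
    and "primitive z" "(cmod z)\<^sup>2 = of_nat (\<Prod>i\<in>A. p i ^ e i)"
  shows "\<exists>u\<in>U. \<exists>\<epsilon>. (\<forall>i\<in>A. \<epsilon> i \<in> {1, -1}) \<and> z = u * (\<Prod>i\<in>A. branch q \<epsilon> i ^ e i)"
  using assms
proof (induction A arbitrary: z rule: finite_induct)
  case empty
  then have "cmod z = 1" by (simp add: power2_eq_1_iff) (smt (verit) norm_ge_zero)
  then have "z \<in> U" using empty by (intro gauss_int_norm_1) (auto simp: primitive_def)
  then show ?case by (intro bexI[of _ z]) auto
next
  case (insert a A)
  define M where "M = (\<Prod>i\<in>A. p i ^ e i)"
  have gp: "gprime (p a) (q a)" "p a \<noteq> 2" using insert.prems by auto
  have norm_z: "(cmod z)\<^sup>2 = of_nat (p a ^ e a * M)"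
    using insert.prems(4) insert.hyps by (simp add: M_def)
  \<comment> \<open>Otherwise the rational prime \<open>p a\<close> would divide the primitive
    \<open>z\<close>. Hence a sign \<open>s\<close> exists for which the conjugate of the selected
    branch is a non-divisor.\<close>
  have "\<not> (gdvd (q a) z \<and> gdvd (cnj (q a)) z)"
    using gprime_both_dvd[OF gp] insert.prems(3) gprime_prime[OF gp(1)]
    by (auto simp: primitive_def)
  then have "\<exists>s \<in> {1, -1 :: int}. \<not> gdvd (cnj (branch q (\<lambda>_. s) a)) z"
    by (auto simp: branch_def)
  then obtain s where s: "s \<in> {1, -1 :: int}" "\<not> gdvd (cnj (branch q (\<lambda>_. s) a)) z" ..
  define r where "r = branch q (\<lambda>_. s) a"
  have r: "gprime (p a) r" using gp by (simp add: r_def)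
  obtain w where w: "w \<in> gauss_int" "z = r ^ e a * w"
    using primitive_eq_power_mult[OF r gp(2) insert.prems(3) norm_z] s by (auto simp: r_def)
  have "of_nat (p a ^ e a) * (cmod w)\<^sup>2 = of_nat (p a ^ e a) * of_nat M"
    using norm_z r w(2)
    by (simp add: norm_mult power_mult_distrib norm_power gprime_def flip: power_mult)
       (simp add: power_mult mult.commute[of _ 2])
  then have "(cmod w)\<^sup>2 = of_nat M"
    using prime_gt_0_nat[OF gprime_prime[OF gp(1)]] by simp
  moreover have "primitive w"
    using primitive_divisor[of "r ^ e a" w] w insert.prems(3) gprime_gauss_int[OF r] by auto
  ultimately obtain u \<epsilon> where u: "u \<in> U" "\<forall>i\<in>A. \<epsilon> i \<in> {1, -1}" "w = u * (\<Prod>i\<in>A. branch q \<epsilon> i ^ e i)"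
    using insert.IH[of w] insert.prems unfolding M_def by blast
  define \<delta> where "\<delta> = \<epsilon>(a := s)"
  have "(\<Prod>i\<in>insert a A. branch q \<delta> i ^ e i) = r ^ e a * (\<Prod>i\<in>A. branch q \<delta> i ^ e i)"
    using insert.hyps by (simp add: \<delta>_def r_def branch_def)
  also have "(\<Prod>i\<in>A. branch q \<delta> i ^ e i) = (\<Prod>i\<in>A. branch q \<epsilon> i ^ e i)"
    using insert.hyps by (intro prod.cong) (auto simp: \<delta>_def branch_def)
  finally have "z = u * (\<Prod>i\<in>insert a A. branch q \<delta> i ^ e i)"
    by (simp add: w u)
  moreover have "\<forall>i\<in>insert a A. \<delta> i \<in> {1, -1}" using u s by (auto simp: \<delta>_def)
  ultimately show ?case using u(1) by blast
qed

section \<open>Products taking one prime from each conjugate pair\<close>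

locale split_primes =
  fixes A :: "'a set" and p :: "'a \<Rightarrow> nat" and q :: "'a \<Rightarrow> complex" and e :: "'a \<Rightarrow> nat"
  assumes finite: "finite A" and inj: "inj_on p A"
    and gprime: "i \<in> A \<Longrightarrow> gprime (p i) (q i)"
    and neq_2: "i \<in> A \<Longrightarrow> p i \<noteq> 2"
    and exp_pos: "i \<in> A \<Longrightarrow> e i > 0"
begin

text \<open>For \<open>e i = 2 * n i\<close> this has modulus \<open>c\<close>, and dividing it by
  \<open>c\<close> gives a product of signed powers of the \<open>zeta (p i)\<close>.\<close>

definition branch_prod :: "('a \<Rightarrow> int) \<Rightarrow> complex" where
  "branch_prod \<epsilon> = (\<Prod>i\<in>A. branch q \<epsilon> i ^ e i)"

lemma branch_prod_gauss_int [simp]: "branch_prod \<epsilon> \<in> gauss_int"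
  unfolding branch_prod_def
  by (intro gauss_int_prod gauss_int_power) (auto simp: gprime_gauss_int[OF gprime])

lemma norm_branch_prod: "(cmod (branch_prod \<epsilon>))\<^sup>2 = of_nat (\<Prod>i\<in>A. p i ^ e i)"
proof -
  have "(cmod (branch_prod \<epsilon>))\<^sup>2 = (\<Prod>i\<in>A. ((cmod (branch q \<epsilon> i))\<^sup>2) ^ e i)"
    by (simp add: branch_prod_def prod_norm[symmetric] norm_power prod_power_distrib
        power_mult[symmetric] mult.commute)
  also have "\<dots> = (\<Prod>i\<in>A. of_nat (p i) ^ e i)"
  proof (rule prod.cong)
    fix i assume "i \<in> A"
    then have "gprime (p i) (branch q \<epsilon> i)" by (simp add: gprime)
    then show "((cmod (branch q \<epsilon> i))\<^sup>2) ^ e i = of_nat (p i) ^ e i"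
      by (simp add: gprime_def)
  qed simp
  finally show ?thesis by simp
qed

text \<open>By Euclid's lemma \<open>r\<close> divides some branch; comparing norms,
  \<open>p j\<close> divides \<open>p i\<close>, and injectivity of \<open>p\<close> identifies the
  index as \<open>j\<close>.\<close>

lemma dvd_branch:
  assumes "j \<in> A" "gprime (p j) r" "gdvd r (branch_prod \<epsilon>)"
  shows "gdvd r (branch q \<epsilon> j)"
proof -
  have g: "i \<in> A \<Longrightarrow> branch q \<epsilon> i \<in> gauss_int" for i
    by (simp add: gprime_gauss_int[OF gprime])
  obtain i where i: "i \<in> A" "gdvd r (branch q \<epsilon> i ^ e i)"
    using gprime_dvd_prod[OF assms(2) finite _ assms(3)[unfolded branch_prod_def]] g by blast
  then have r: "gdvd r (branch q \<epsilon> i)"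
    using gprime_dvd_power[OF assms(2)] g by blast
  have "gprime (p i) (branch q \<epsilon> i)" by (simp add: gprime i)
  then have "p j dvd p i" "prime (p i)"
    using gdvd_norm[OF r] assms(2) by (auto simp: gprime_def)
  moreover have "prime (p j)" using assms(2) by (simp add: gprime_def)
  ultimately have "p j = p i" by (simp add: primes_dvd_imp_eq)
  then have "i = j" using inj i assms(1) by (auto dest: inj_onD)
  with r show ?thesis by simp
qed

text \<open>The sign at \<open>j\<close> can be read off from divisibility. The selected branch
  divides because its exponent is positive; if the other one did too, \<open>dvd_branch\<close>
  would make it divide its own conjugate.\<close>

lemma dvd_branch_prod_iff:
  assumes "j \<in> A"
  shows "gdvd (q j) (branch_prod \<epsilon>) \<longleftrightarrow> \<epsilon> j = 1"
    and "gdvd (cnj (q j)) (branch_prod \<epsilon>) \<longleftrightarrow> \<epsilon> j \<noteq> 1"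
proof -
  note gp = gprime[OF assms] neq_2[OF assms]
  have "gdvd (branch q \<epsilon> j) (branch_prod \<epsilon>)"
  proof -
    have "branch_prod \<epsilon> = branch q \<epsilon> j * (branch q \<epsilon> j ^ (e j - 1) * (\<Prod>i\<in>A - {j}. branch q \<epsilon> i ^ e i))"
      using exp_pos[OF assms]
      by (simp add: branch_prod_def prod.remove[OF finite assms] power_eq_if mult.assoc)
    moreover have "branch q \<epsilon> j ^ (e j - 1) * (\<Prod>i\<in>A - {j}. branch q \<epsilon> i ^ e i) \<in> gauss_int"
      using assms
      by (intro gauss_int_mult gauss_int_prod gauss_int_power)
         (auto simp: gprime_gauss_int[OF gprime])
    ultimately show ?thesis unfolding gdvd_def by blast
  qed
  moreover have "\<not> gdvd (cnj (q j)) (q j)" "\<not> gdvd (q j) (cnj (q j))"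
    using gprime_not_dvd_cnj[OF gp] by (simp_all add: gdvd_cnj_iff)
  ultimately show "gdvd (q j) (branch_prod \<epsilon>) \<longleftrightarrow> \<epsilon> j = 1"
    and "gdvd (cnj (q j)) (branch_prod \<epsilon>) \<longleftrightarrow> \<epsilon> j \<noteq> 1"
    using dvd_branch[OF assms, of "q j" \<epsilon>] dvd_branch[OF assms, of "cnj (q j)" \<epsilon>] gp
    by (auto simp: branch_def split: if_splits)
qed

text \<open>Comparing norms, a rational prime divisor would be some \<open>p i\<close>, so both
  \<open>q i\<close> and its conjugate would divide, demanding contradictory signs.\<close>

lemma primitive_branch_prod: "primitive (branch_prod \<epsilon>)"
  unfolding primitive_def
proof (intro conjI allI impI notI)
  fix r :: nat
  assume r: "prime r" "gdvd (of_nat r) (branch_prod \<epsilon>)"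
  have "r\<^sup>2 dvd (\<Prod>i\<in>A. p i ^ e i)"
    by (rule gdvd_norm[OF r(2) _ norm_branch_prod]) simp
  then have "r dvd (\<Prod>i\<in>A. p i ^ e i)"
    by (rule dvd_trans[rotated]) simp
  then obtain i where i: "i \<in> A" "r dvd p i ^ e i"
    using prime_dvd_prod_iff[OF finite, of r] r(1) by auto
  then have "r dvd p i" using r(1) prime_dvd_power by blast
  then have "r = p i" using primes_dvd_imp_eq[OF r(1) gprime_prime[OF gprime[OF i(1)]]] by simp
  then have "gdvd (q i) (branch_prod \<epsilon>)" "gdvd (cnj (q i)) (branch_prod \<epsilon>)"
    using r(2) gprime[OF i(1)] by (auto intro: of_nat_gdvd_imp_gprime_dvd)
  then show False using dvd_branch_prod_iff[OF i(1)] by blast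
qed simp

text \<open>A unit factor does not affect which of \<open>q j\<close> and \<open>cnj (q j)\<close>
  divides, and that determines the sign at \<open>j\<close>.\<close>

lemma branch_prod_unit_multiple:
  assumes "branch_prod \<epsilon> = u * branch_prod \<delta>" "u \<in> U" "j \<in> A"
  shows "\<epsilon> j = 1 \<longleftrightarrow> \<delta> j = 1"
proof -
  have "\<delta> j = 1 \<Longrightarrow> \<epsilon> j = 1"
    using dvd_branch_prod_iff(1)[OF assms(3)] assms(1,2) gdvd_mult2 gauss_int_U by metis
  moreover have "\<delta> j \<noteq> 1 \<Longrightarrow> \<epsilon> j \<noteq> 1"
    using dvd_branch_prod_iff(2)[OF assms(3)] assms(1,2) gdvd_mult2 gauss_int_U by metis
  ultimately show ?thesis by blast
qed

text \<open>Conjugation flips every branch. Signs are restricted to 1 and -1 because negating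
  another value, such as 0, need not change the branch.\<close>

lemma cnj_branch_prod:
  assumes "\<forall>i\<in>A. \<epsilon> i \<in> {1, -1}"
  shows "cnj (branch_prod \<epsilon>) = branch_prod (\<lambda>i. - \<epsilon> i)"
  using assms unfolding branch_prod_def cnj_prod
  by (intro prod.cong) (auto simp: branch_def)

end

section \<open>Sums of two squares\<close>

text \<open>Euler's criterion: \<open>(p - 1) div 2\<close> is even, so the Legendre symbol of -1 is
  congruent to 1.\<close>

lemma prime_1_mod_4_sqrt_minus_1:
  fixes p :: nat
  assumes "prime p" "[p = 1] (mod 4)"
  shows "\<exists>x::int. int p dvd x\<^sup>2 + 1"
proof -
  have "p mod 4 = 1" using assms(2) by (simp add: cong_def)
  then obtain k where k: "p = 4 * k + 1" by (metis mult_div_mod_eq)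
  have p2: "p > 2" using k prime_gt_1_nat[OF assms(1)] by auto
  have "[Legendre (-1) (int p) = (-1) ^ ((p - 1) div 2)] (mod int p)"
    using euler_criterion[OF assms(1) p2] .
  also have "(-1 :: int) ^ ((p - 1) div 2) = 1" by (simp add: k)
  finally have L: "[Legendre (-1) (int p) = 1] (mod int p)" .
  have "QuadRes (int p) (-1)"
  proof (rule ccontr)
    assume *: "\<not> QuadRes (int p) (-1)"
    \<comment> \<open>A non-residue has symbol 0 or -1, which makes this difference 1 or 2, too
      small for a multiple of \<open>p > 2\<close>.\<close>
    have "int p dvd 1 - Legendre (-1) (int p)" using L cong_iff_dvd_diff cong_sym by blast
    moreover have "1 - Legendre (-1) (int p) \<in> {1, 2}" using * by (auto simp: Legendre_def)
    ultimately show False using p2 by (auto dest: zdvd_imp_le)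
  qed
  then show ?thesis by (auto simp: QuadRes_def cong_iff_dvd_diff)
qed

lemma prime_not_square: "prime (p::nat) \<Longrightarrow> p \<noteq> m\<^sup>2"
  using prime_product[of m m] by (auto simp: power2_eq_square)

text \<open>Thue's pigeonhole argument on \<open>u - x v\<close> modulo \<open>p\<close> with \<open>0 \<le> u, v < \<surd>p\<close> and \<open>x\<^sup>2 = -1\<close>.\<close>

lemma prime_1_mod_4_two_squares:
  fixes p :: nat
  assumes "prime p" "[p = 1] (mod 4)"
  shows "\<exists>m n. 0 < m \<and> m < n \<and> p = m\<^sup>2 + n\<^sup>2"
proof -
  obtain x :: int where x: "int p dvd x\<^sup>2 + 1"
    using prime_1_mod_4_sqrt_minus_1[OF assms] by blast
  have p0: "p > 0" using assms(1) prime_gt_0_nat by blast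
  \<comment> \<open>Both inequalities around \<open>p\<close> are strict as a prime is not a square:
    the upper one yields more than \<open>p\<close> pairs, the lower one keeps differences below the
    square root of \<open>p\<close>.\<close>
  define r where "r = floor_sqrt p"
  have r1: "r\<^sup>2 < p" "p < (r + 1)\<^sup>2"
    using prime_not_square[OF assms(1), of r] floor_sqrt_power2_le[of p] Suc_floor_sqrt_power2_gt[of p]
    by (auto simp: r_def order.strict_iff_order)
  define D where "D = {0..int r} \<times> {0..int r}"
  define f where "f = (\<lambda>(u, v). (u - x * v) mod int p)"
  have "f ` D \<subseteq> {0..<int p}" using p0 by (auto simp: f_def)
  then have "card (f ` D) \<le> p" using card_mono[of "{0..<int p}" "f ` D"] by simp
  also have "p < card D" using r1 by (simp add: D_def power2_eq_square nat_add_distrib)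
  finally have "\<not> inj_on f D" by (rule pigeonhole)
  then obtain u v u' v' where uv: "(u, v) \<in> D" "(u', v') \<in> D" "(u, v) \<noteq> (u', v')" "f (u, v) = f (u', v')"
    unfolding inj_on_def by (metis surj_pair)
  define a b where "a = u - u'" and "b = v - v'"
  have "int p dvd (u - x * v) - (u' - x * v')"
    using uv(4) by (simp add: f_def mod_eq_dvd_iff)
  then have "int p dvd a - x * b" by (simp add: a_def b_def algebra_simps)
  \<comment> \<open>Since \<open>x\<^sup>2\<close> is -1 modulo \<open>p\<close>, the difference of
    squares becomes the sum \<open>a\<^sup>2 + b\<^sup>2\<close>. It is positive and below
    \<open>2 * p\<close>, hence equal to \<open>p\<close>.\<close>
  then have "int p dvd (a - x * b) * (a + x * b) + (x\<^sup>2 + 1) * b\<^sup>2" using x by simp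
  also have "(a - x * b) * (a + x * b) + (x\<^sup>2 + 1) * b\<^sup>2 = a\<^sup>2 + b\<^sup>2"
    by (simp add: algebra_simps power2_eq_square)
  finally obtain t where t: "a\<^sup>2 + b\<^sup>2 = int p * t" by (elim dvdE)
  have "\<bar>a\<bar> \<le> int r" "\<bar>b\<bar> \<le> int r" using uv by (auto simp: a_def b_def D_def)
  then have "a\<^sup>2 \<le> (int r)\<^sup>2" "b\<^sup>2 \<le> (int r)\<^sup>2" by (simp_all add: power2_le_iff_abs_le)
  moreover have "(int r)\<^sup>2 < int p" using r1 by (metis of_nat_less_iff of_nat_power)
  ultimately have "int p * t < int p * 2" unfolding t[symmetric] by linarith
  then have "t < 2" using p0 by simp
  have "a \<noteq> 0 \<or> b \<noteq> 0" using uv(3) by (auto simp: a_def b_def)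
  then have "int p * t > 0" by (simp add: sum_power2_gt_zero_iff flip: t)
  then have "t > 0" using p0 by (simp add: zero_less_mult_iff)
  with \<open>t < 2\<close> have "t = 1" by simp
  define m n where "m = nat (min \<bar>a\<bar> \<bar>b\<bar>)" and "n = nat (max \<bar>a\<bar> \<bar>b\<bar>)"
  have "int p = (int m)\<^sup>2 + (int n)\<^sup>2"
    using t \<open>t = 1\<close> by (auto simp: m_def n_def min_def max_def)
  then have pmn: "p = m\<^sup>2 + n\<^sup>2" by (metis of_nat_add of_nat_eq_iff of_nat_power)
  have "m \<le> n" by (simp add: m_def n_def)
  moreover have "m \<noteq> n"
  proof
    assume "m = n"
    then have "even p" using pmn by simp
    then show False using assms(2) by (auto simp: cong_def elim!: evenE) presburger
  qed
  moreover have "m \<noteq> 0" using pmn prime_not_square[OF assms(1), of n] by auto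
  ultimately show ?thesis using pmn by (intro exI[of _ m] exI[of _ n]) auto
qed

lemma gprime_of_two_squares:
  assumes "prime p" "p = m\<^sup>2 + n\<^sup>2"
  shows "gprime p (of_nat m + of_nat n * \<i>)"
  using assms by (simp add: gprime_def gauss_int_def cmod_power2)

text \<open>Both representations give Gaussian primes over \<open>p\<close>, so they agree up to
  conjugation and a unit. Among the eight candidates only the identity respects positivity and the
  order of the parts.\<close>

lemma two_squares_unique:
  fixes p m n m' n' :: nat
  assumes "prime p" "0 < m" "m < n" "p = m\<^sup>2 + n\<^sup>2" "0 < m'" "m' < n'" "p = m'\<^sup>2 + n'\<^sup>2"
  shows "m = m' \<and> n = n'"
proof -
  define q q' where "q = of_nat m + of_nat n * \<i>" and "q' = of_nat m' + of_nat n' * \<i>"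
  have gp: "gprime p q" "gprime p q'"
    unfolding q_def q'_def using assms gprime_of_two_squares by blast+
  have unit: "w \<in> U" if "w \<in> gauss_int" "q' = r * w" "gprime p r" for r w
  proof (rule gauss_int_norm_1)
    have "of_nat p * (cmod w)\<^sup>2 = of_nat p * 1"
      using that gp by (simp add: gprime_def norm_mult power_mult_distrib)
    then have "(cmod w)\<^sup>2 = 1" using prime_gt_0_nat[OF assms(1)] by simp
    then show "cmod w = 1" by (simp add: power2_eq_1_iff) (smt (verit) norm_ge_zero)
  qed fact
  have "gdvd q q' \<or> gdvd (cnj q) q'"
    using gp by (intro gprime_dvd_of_norm_dvd[of p q q' p]) (auto simp: gprime_def)
  then obtain w where "w \<in> U" "q' = q * w \<or> q' = cnj q * w"
    unfolding gdvd_def using unit gp by (metis gprime_cnj)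
  then show ?thesis
    using assms(2,3,5,6) by (auto simp: U_def q_def q'_def complex_eq_iff)
qed

text \<open>Resolves the definite description in \<open>two_squares\<close>; afterwards
  \<open>zeta p\<close> enters only through the prime \<open>q\<close>.\<close>

lemma zeta_eq_quotient:
  assumes "prime p" "[p = 1] (mod 4)"
  obtains q where "gprime p q" "zeta p = q / cnj q"
proof -
  obtain m n where mn: "0 < m" "m < n" "p = m\<^sup>2 + n\<^sup>2"
    using prime_1_mod_4_two_squares[OF assms] by blast
  then have "two_squares p = (m, n)"
    unfolding two_squares_def
    by (intro the_equality) (auto dest: two_squares_unique[OF assms(1) mn])
  then have "zeta p = (of_nat m + of_nat n * \<i>) / cnj (of_nat m + of_nat n * \<i>)"
    by (simp add: zeta_def)
  then show thesis using that gprime_of_two_squares[OF assms(1) mn(3)] by blast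
qed

section \<open>Normalized pythagorean triples\<close>

lemma PT_iff:
  "(a, b, c') \<in> PT c \<longleftrightarrow>
    c' = c \<and> pythagorean_triple (a, b, c) \<and> normalized_triple (a, b, c)"
  by (auto simp: PT_def)

text \<open>A prime common to both legs divides \<open>c\<^sup>2\<close>, hence \<open>c\<close>,
  against the gcd condition on the whole triple.\<close>

lemma PT_coprime:
  assumes "(a, b, c) \<in> PT c"
  shows "coprime a b"
proof (rule ccontr)
  have abc: "a\<^sup>2 + b\<^sup>2 = c\<^sup>2" "Gcd {a, b, c} = 1"
    using assms unfolding PT_iff pythagorean_triple_def normalized_triple_def prod.case by blast+
  assume "\<not> coprime a b"
  then have "gcd a b \<noteq> 1" using coprime_iff_gcd_eq_1 by blast
  then obtain r where r: "prime r" "r dvd gcd a b" using prime_factor_nat by blast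
  then have ab: "r dvd a" "r dvd b" by auto
  then have "r dvd a\<^sup>2 + b\<^sup>2" by (simp add: power2_eq_square)
  then have "r dvd c\<^sup>2" by (simp only: abc)
  then have "r dvd c" using r(1) prime_dvd_power by blast
  with ab have "r dvd Gcd {a, b, c}" by (intro Gcd_greatest) auto
  with abc(2) r(1) show False by simp
qed

text \<open>If \<open>p = 4 * k + 3\<close>, raising the congruence of \<open>a\<^sup>2\<close> and
  \<open>- b\<^sup>2\<close> to the odd power \<open>(p - 1) div 2 = 2 * k + 1\<close> gives 1 = -1
  modulo \<open>p\<close> by Fermat's theorem, as \<open>p\<close> divides neither \<open>a\<close>
  nor \<open>b\<close>.\<close>

lemma prime_dvd_sum_two_squares:
  fixes p a b :: nat
  assumes "prime p" "odd p" "coprime a b" "p dvd a\<^sup>2 + b\<^sup>2"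
  shows "[p = 1] (mod 4)"
proof (rule ccontr)
  assume "\<not> [p = 1] (mod 4)"
  then have "p mod 4 = 3" using assms(2) by (simp add: cong_def) presburger
  then obtain k where k: "p = 4 * k + 3" by (metis mult_div_mod_eq)
  have "\<not> (p dvd a \<and> p dvd b)"
    using assms(1,3) coprime_common_divisor_nat[of a b p] by auto
  moreover have "p dvd a \<longleftrightarrow> p dvd b"
  proof -
    have "p dvd a\<^sup>2 \<longleftrightarrow> p dvd b\<^sup>2"
      using assms(4) by (metis dvd_add_left_iff dvd_add_right_iff)
    then show ?thesis using assms(1) by (simp add: prime_dvd_power_iff)
  qed
  ultimately have "\<not> p dvd a" "\<not> p dvd b" by auto
  then have "[a ^ (p - 1) = 1] (mod p)" "[b ^ (p - 1) = 1] (mod p)"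
    using fermat_theorem[OF assms(1)] by auto
  then have 1: "[int a ^ (p - 1) = 1] (mod int p)" "[int b ^ (p - 1) = 1] (mod int p)"
    by (simp_all flip: cong_int_iff)
  have p1: "p - 1 = 2 * (2 * k + 1)" by (simp add: k)
  have "int p dvd (int a)\<^sup>2 - (- ((int b)\<^sup>2))"
    using assms(4) by (simp flip: of_nat_power of_nat_add)
  then have "[(int a)\<^sup>2 = - ((int b)\<^sup>2)] (mod int p)" by (simp add: cong_iff_dvd_diff)
  then have "[((int a)\<^sup>2) ^ (2 * k + 1) = (- ((int b)\<^sup>2)) ^ (2 * k + 1)] (mod int p)"
    by (rule cong_pow)
  also have "(- ((int b)\<^sup>2)) ^ (2 * k + 1) = - (int b ^ (p - 1))"
    unfolding p1 by (subst power_minus_odd, simp) (simp only: power_mult)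
  also have "((int a)\<^sup>2) ^ (2 * k + 1) = int a ^ (p - 1)"
    unfolding p1 by (simp only: power_mult)
  finally have "[1 = - (1::int)] (mod int p)"
    using 1 by (meson cong_minus_minus_iff cong_sym cong_trans)
  then have "int p dvd 2" by (simp add: cong_iff_dvd_diff)
  then have "int p \<le> 2" by (rule zdvd_imp_le) simp
  with k show False by simp
qed

text \<open>An even hypotenuse would make \<open>a\<^sup>2 + b\<^sup>2\<close> divisible by 4;
  squares are 0 or 1 modulo 4, so both legs would be even. Hence \<open>p\<close> is odd and
  \<open>prime_dvd_sum_two_squares\<close> applies.\<close>

lemma PT_prime_divisor:
  assumes "(a, b, c) \<in> PT c" "prime p" "p dvd c"
  shows "[p = 1] (mod 4)"
proof -
  have abc: "a\<^sup>2 + b\<^sup>2 = c\<^sup>2"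
    using assms unfolding PT_iff pythagorean_triple_def prod.case by blast
  have cop: "coprime a b" using assms(1) by (rule PT_coprime)
  have "odd c"
  proof
    assume "even c"
    then have "4 dvd c\<^sup>2" by (auto simp: power2_eq_square elim!: evenE)
    then have "4 dvd a\<^sup>2 + b\<^sup>2" by (simp add: abc)
    then have "(a\<^sup>2 + b\<^sup>2) mod 4 = 0" by simp
    have sq: "x\<^sup>2 mod 4 = of_bool (odd x)" for x :: nat
    proof (cases "even x")
      case True
      then show ?thesis by (auto simp: power2_eq_square elim!: evenE)
    next
      case False
      then obtain y where "x = 2 * y + 1" by (elim oddE)
      then have "x\<^sup>2 = 4 * (y\<^sup>2 + y) + 1" by (simp add: power2_eq_square algebra_simps)
      then have "x\<^sup>2 mod 4 = 1" by (metis mod_mult_self4 mod_less one_less_numeral_iff semiring_norm(76))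
      with False show ?thesis by simp
    qed
    have "(a\<^sup>2 + b\<^sup>2) mod 4 = (of_bool (odd a) + of_bool (odd b)) mod 4"
      by (metis sq mod_add_eq)
    also have "\<dots> \<noteq> 0"
      using cop coprime_common_divisor_nat[of a b 2] by (cases "even a"; cases "even b") auto
    finally show False using \<open>(a\<^sup>2 + b\<^sup>2) mod 4 = 0\<close> by blast
  qed
  then have "odd p" using assms(3) dvd_trans by blast
  moreover have "p dvd a\<^sup>2 + b\<^sup>2" unfolding abc using assms(3) by (simp add: power2_eq_square)
  ultimately show ?thesis using prime_dvd_sum_two_squares assms(2) cop by blast
qed

text \<open>After cross-multiplication, \<open>c'\<close> times the first triple equals
  \<open>c\<close> times the second. Their gcds are \<open>c'\<close> and \<open>c\<close>.\<close>

lemma normalized_triple_unique: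
  assumes "pythagorean_triple (a, b, c)" "normalized_triple (a, b, c)"
    and "pythagorean_triple (a', b', c')" "normalized_triple (a', b', c')"
    and "real a / real c = real a' / real c'" "real b / real c = real b' / real c'"
  shows "(a, b, c) = (a', b', c')"
proof -
  have pos: "c > 0" "c' > 0" using assms by (auto simp: pythagorean_triple_def)
  have "real (a * c') = real (a' * c)" "real (b * c') = real (b' * c)"
    using assms(5,6) pos by (simp_all add: field_simps)
  then have eq: "c' * a = c * a'" "c' * b = c * b'"
    by (simp_all only: of_nat_eq_iff mult.commute[of a] mult.commute[of b] mult.commute[of a'] mult.commute[of b'])
  have 1: "gcd a (gcd b c) = 1" "gcd a' (gcd b' c') = 1"
    using assms by (simp_all add: normalized_triple_def)
  have "c' = c' * gcd a (gcd b c)" using 1 by simp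
  also have "\<dots> = gcd (c' * a) (gcd (c' * b) (c' * c))" by (simp only: gcd_mult_distrib_nat)
  also have "\<dots> = gcd (c * a') (gcd (c * b') (c * c'))" unfolding eq mult.commute[of c' c] ..
  also have "\<dots> = c * gcd a' (gcd b' c')" by (simp only: gcd_mult_distrib_nat)
  also have "\<dots> = c" using 1 by simp
  finally have "c' = c" .
  with eq pos show ?thesis by simp
qed

section \<open>Evaluation of \<open>pt\<close> on primitive Gaussian integers divided by their
  modulus\<close>

lemma pt_eqI:
  assumes "pythagorean_triple (a, b, c)" "normalized_triple (a, b, c)"
    and "real a / real c = min (abs (Re \<zeta>)) (abs (Im \<zeta>))" "real b / real c = max (abs (Re \<zeta>)) (abs (Im \<zeta>))"
  shows "pt \<zeta> = (a, b, c)"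
  unfolding pt_def
proof (rule the_equality)
  show "case (a, b, c) of (a, b, c) \<Rightarrow> pythagorean_triple (a, b, c) \<and> normalized_triple (a, b, c) \<and>
     real a / real c = min (abs (Re \<zeta>)) (abs (Im \<zeta>)) \<and> real b / real c = max (abs (Re \<zeta>)) (abs (Im \<zeta>))"
    using assms by simp
next
  fix t :: "nat \<times> nat \<times> nat"
  assume *: "case t of (a, b, c) \<Rightarrow> pythagorean_triple (a, b, c) \<and> normalized_triple (a, b, c) \<and>
     real a / real c = min (abs (Re \<zeta>)) (abs (Im \<zeta>)) \<and> real b / real c = max (abs (Re \<zeta>)) (abs (Im \<zeta>))"
  obtain x y z where t: "t = (x, y, z)" by (cases t)
  with * show "t = (a, b, c)"
    using normalized_triple_unique[of x y z a b c] assms by simp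
qed

text \<open>The legs are the sorted absolute coordinates of \<open>z\<close> itself: coprimality
  means that the fractions over \<open>c\<close> are already reduced to a normalized triple.\<close>

lemma pt_primitive:
  assumes "primitive z" "cmod z = of_nat c" "c > 1"
  defines "\<zeta> \<equiv> z / of_nat c"
  shows "\<zeta> \<in> GQ - U"
    and "\<exists>a b. pt \<zeta> = (a, b, c) \<and> (a, b, c) \<in> PT c \<and>
           real a = min (abs (Re z)) (abs (Im z)) \<and> real b = max (abs (Re z)) (abs (Im z))"
proof -
  from assms(1) have "z \<in> gauss_int" by (simp add: primitive_def)
  then obtain x y where z: "z = Complex (of_int x) (of_int y)" by (rule gauss_intE)
  have xy: "coprime x y" using assms(1) unfolding z by (simp only: primitive_Complex_iff)
  have "real_of_int (x\<^sup>2 + y\<^sup>2) = of_int ((int c)\<^sup>2)"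
    using arg_cong[OF assms(2), of "\<lambda>r. r\<^sup>2"] by (simp add: z cmod_power2)
  then have norm: "x\<^sup>2 + y\<^sup>2 = (int c)\<^sup>2" by (simp only: of_int_eq_iff)
  \<comment> \<open>If one coordinate vanished, coprimality would make the other 1 or -1, while its
    square is \<open>c\<^sup>2 > 1\<close>.\<close>
  have xy0: "x \<noteq> 0" "y \<noteq> 0"
  proof -
    have "\<not> \<bar>v\<bar> = 1" if "v\<^sup>2 = (int c)\<^sup>2" for v
      using that assms(3) by (auto simp: power2_eq_iff)
    then show "x \<noteq> 0" "y \<noteq> 0" using xy norm by auto
  qed
  have \<zeta>: "Re \<zeta> = of_int x / of_nat c" "Im \<zeta> = of_int y / of_nat c"
    by (simp_all add: \<zeta>_def z Re_divide_of_nat Im_divide_of_nat)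
  have "(Re \<zeta>)\<^sup>2 + (Im \<zeta>)\<^sup>2 = of_int (x\<^sup>2 + y\<^sup>2) / (of_nat c)\<^sup>2"
    by (simp add: \<zeta> power_divide add_divide_distrib)
  also have "\<dots> = 1" using assms(3) by (simp add: norm)
  finally have "(Re \<zeta>)\<^sup>2 + (Im \<zeta>)\<^sup>2 = 1" .
  moreover have "Re \<zeta> \<in> \<rat>" "Im \<zeta> \<in> \<rat>" by (simp_all add: \<zeta>)
  ultimately have "\<zeta> \<in> GQ"
    unfolding GQ_def mem_Collect_eq
    by (intro exI[of _ "Re \<zeta>"] exI[of _ "Im \<zeta>"]) (simp add: complex_eq_iff)
  moreover have "\<zeta> \<notin> U"
  proof -
    have "Re \<zeta> \<noteq> 0" "Im \<zeta> \<noteq> 0" using xy0 assms(3) by (simp_all add: \<zeta>)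
    then show ?thesis by (auto simp: U_def)
  qed
  ultimately show "\<zeta> \<in> GQ - U" by simp
  define a b where "a = nat (min \<bar>x\<bar> \<bar>y\<bar>)" and "b = nat (max \<bar>x\<bar> \<bar>y\<bar>)"
  have ab: "real a = min (abs (Re z)) (abs (Im z))" "real b = max (abs (Re z)) (abs (Im z))"
    by (simp_all add: a_def b_def z of_int_min of_int_max)
  have "int (a\<^sup>2 + b\<^sup>2) = int (c\<^sup>2)"
    using norm by (auto simp: a_def b_def min_def max_def)
  then have "a\<^sup>2 + b\<^sup>2 = c\<^sup>2" by (simp only: of_nat_eq_iff)
  then have pyth: "pythagorean_triple (a, b, c)"
    using xy0 assms(3) by (simp add: pythagorean_triple_def a_def b_def min_def max_def)
  have "coprime (int a) (int b)"
    using xy by (auto simp: a_def b_def min_def max_def coprime_commute)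
  then have "gcd a b = 1" by simp
  then have "Gcd {a, b, c} = 1" by (simp only: Gcd_insert Gcd_empty gcd_0_right gcd.assoc[symmetric]) simp
  moreover have "a \<le> b" by (simp add: a_def b_def)
  ultimately have nrm: "normalized_triple (a, b, c)" by (simp add: normalized_triple_def)
  have "pt \<zeta> = (a, b, c)"
    using pyth nrm
  proof (rule pt_eqI)
    show "real a / real c = min (abs (Re \<zeta>)) (abs (Im \<zeta>))" "real b / real c = max (abs (Re \<zeta>)) (abs (Im \<zeta>))"
      using assms(3) by (simp_all add: ab \<zeta> z min_def max_def divide_le_cancel abs_divide)
  qed
  then show "\<exists>a b. pt \<zeta> = (a, b, c) \<and> (a, b, c) \<in> PT c \<and>
      real a = min (abs (Re z)) (abs (Im z)) \<and> real b = max (abs (Re z)) (abs (Im z))"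
    using pyth nrm ab by (auto simp: PT_iff)
qed

section \<open>Units, conjugation and the bijection\<close>

lemma abs_parts_unit_multiple:
  assumes "u \<in> U"
  shows "min (abs (Re (u * w))) (abs (Im (u * w))) = min (abs (Re w)) (abs (Im w))"
    and "max (abs (Re (u * w))) (abs (Im (u * w))) = max (abs (Re w)) (abs (Im w))"
  using assms by (auto simp: U_def min.commute max.commute)

text \<open>Equal sorted absolute coordinates mean that \<open>z\<close> and \<open>w\<close> differ
  by a symmetry of the square: a quarter-turn rotation, possibly after a reflection.\<close>

lemma unit_multiple_of_abs_eq:
  assumes "min (abs (Re z)) (abs (Im z)) = min (abs (Re w)) (abs (Im w))"
    and "max (abs (Re z)) (abs (Im z)) = max (abs (Re w)) (abs (Im w))"
  shows "\<exists>u\<in>U. z = u * w \<or> z = u * cnj w"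
proof -
  have "abs (Re z) = abs (Re w) \<and> abs (Im z) = abs (Im w) \<or>
      abs (Re z) = abs (Im w) \<and> abs (Im z) = abs (Re w)"
    using assms unfolding min_def max_def by (auto split: if_splits)
  then have "z \<in> {w, - w, \<i> * w, - \<i> * w} \<or> z \<in> {cnj w, - cnj w, \<i> * cnj w, - \<i> * cnj w}"
    by (auto simp: complex_eq_iff abs_eq_iff)
  then show ?thesis unfolding U_def by auto
qed

text \<open>Here \<open>q / cnj q = q\<^sup>2 / p\<close>, and inversion swaps \<open>q\<close> with
  its conjugate, so the sign of an exponent becomes a choice of branch. The exponents keep the shape
  sign times \<open>int n\<close> used in the theorem.\<close>

lemma gprime_quotient_power:
  assumes "gprime p q"
  shows "(q / cnj q) powi (1 * int n) = q ^ (2 * n) / of_nat (p ^ n)"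
    and "(q / cnj q) powi (-1 * int n) = cnj q ^ (2 * n) / of_nat (p ^ n)"
proof -
  have q: "q * cnj q = of_nat p" using assms by (rule gprime_mult_cnj)
  have "q \<noteq> 0"
    using assms by (auto simp: gprime_def)
  then have *: "q / cnj q = q\<^sup>2 / of_nat p" "cnj q / q = (cnj q)\<^sup>2 / of_nat p"
    by (simp_all add: power2_eq_square field_simps flip: q)
  show "(q / cnj q) powi (1 * int n) = q ^ (2 * n) / of_nat (p ^ n)"
    by (simp add: * power_divide power_mult)
  have "(q / cnj q) powi (-1 * int n) = (cnj q / q) ^ n"
    by (simp add: power_int_minus power_divide)
  then show "(q / cnj q) powi (-1 * int n) = cnj q ^ (2 * n) / of_nat (p ^ n)"
    by (simp add: * power_divide power_mult)
qed

theorem theorem5p2: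
  fixes c k :: nat and p n :: "nat \<Rightarrow> nat" and S :: "complex set"
  assumes "c > 1" and "k \<ge> 1"
    and "\<And>i. i \<in> {1..k} \<Longrightarrow> prime (p i)"
    and "inj_on p {1..k}"
    and "\<And>i. i \<in> {1..k} \<Longrightarrow> n i > 0"
    and "c = (\<Prod>i = 1..k. p i ^ n i)"
  defines "S \<equiv> {zeta (p 1) ^ n 1 * (\<Prod>i = 2..k. zeta (p i) powi (\<epsilon> i * int (n i))) | \<epsilon> :: nat \<Rightarrow> int.
                  \<forall>i \<in> {2..k}. \<epsilon> i \<in> {1, -1}}"
  shows "((\<forall>i \<in> {1..k}. [p i = 1] (mod 4)) \<longrightarrow> S \<subseteq> GQ - U \<and> bij_betw pt S (PT c))
       \<and> (\<not> (\<forall>i \<in> {1..k}. [p i = 1] (mod 4)) \<longrightarrow> PT c = {})"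
proof (intro conjI impI)
  assume "\<not> (\<forall>i \<in> {1..k}. [p i = 1] (mod 4))"
  then obtain i where i: "i \<in> {1..k}" "\<not> [p i = 1] (mod 4)" by blast
  have "p i dvd p i ^ n i" using assms(5)[OF i(1)] by simp
  also have "\<dots> dvd c" unfolding assms(6) using i(1) by (intro dvd_prodI) auto
  finally have "p i dvd c" .
  \<comment> \<open>Every prime divisor of a normalized hypotenuse is 1 modulo 4, but
    \<open>p i\<close> is not.\<close>
  then have "(a, b, c') \<notin> PT c" for a b c'
    using PT_prime_divisor[OF _ assms(3)[OF i(1)]] i(2) PT_iff by metis
  then show "PT c = {}" by auto
next
  assume mod4: "\<forall>i \<in> {1..k}. [p i = 1] (mod 4)"
  have "\<forall>i\<in>{1..k}. \<exists>q. gprime (p i) q \<and> zeta (p i) = q / cnj q"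
    using zeta_eq_quotient assms(3) mod4 by metis
  then obtain q where q: "\<And>i. i \<in> {1..k} \<Longrightarrow> gprime (p i) (q i)"
    "\<And>i. i \<in> {1..k} \<Longrightarrow> zeta (p i) = q i / cnj (q i)"
    by metis
  have neq_2: "p i \<noteq> 2" if "i \<in> {1..k}" for i
  proof -
    have "p i mod 4 = 1" using mod4 that by (simp add: cong_def)
    then show ?thesis by auto
  qed
  \<comment> \<open>The exponents are doubled because the relevant norm is
    \<open>c\<^sup>2\<close>.\<close>
  interpret split_primes "{1..k}" p q "\<lambda>i. 2 * n i"
    using assms(4,5) q neq_2 by unfold_locales auto
  have c2: "(\<Prod>i = 1..k. p i ^ (2 * n i)) = c\<^sup>2"
    by (simp add: assms(6) prod_power_distrib power_mult mult.commute[of 2])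
  have norm: "cmod (branch_prod \<epsilon>) = of_nat c" for \<epsilon>
    using norm_branch_prod[of \<epsilon>] unfolding c2 by (simp add: power2_eq_iff_nonneg)
  note pt = pt_primitive[OF primitive_branch_prod norm assms(1)]
  \<comment> \<open>Fixing the first sign picks one of each pair of conjugate products. Values
    outside \<open>{1..k}\<close> are free, so \<open>E\<close> parametrizes \<open>S\<close> with
    repetitions.\<close>
  define E where "E = {\<epsilon> :: nat \<Rightarrow> int. \<epsilon> 1 = 1 \<and> (\<forall>i\<in>{1..k}. \<epsilon> i \<in> {1, -1})}"

  have factor: "zeta (p i) powi (s * int (n i)) = branch q \<epsilon> i ^ (2 * n i) / of_nat (p i ^ n i)"
    if "i \<in> {1..k}" "s \<in> {1, -1}" "\<epsilon> i = s" for i s \<epsilon>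
    using gprime_quotient_power[OF q(1)[OF that(1)], of "n i"] q(2)[OF that(1)] that
    by (auto simp: branch_def)
  have split: "{1..k} = insert 1 {2..k}" using assms(2) by auto
  \<comment> \<open>In \<open>S\<close> the value \<open>\<epsilon> 1\<close> is unconstrained; the
    update to 1 absorbs the unsigned first factor into the product over all primes.\<close>
  have elem: "zeta (p 1) ^ n 1 * (\<Prod>i = 2..k. zeta (p i) powi (\<epsilon> i * int (n i)))
      = branch_prod (\<epsilon>(1 := 1)) / of_nat c"
    if "\<forall>i \<in> {2..k}. \<epsilon> i \<in> {1, -1}" for \<epsilon> :: "nat \<Rightarrow> int"
  proof -
    let ?\<delta> = "\<epsilon>(1 := 1)"
    have "zeta (p 1) ^ n 1 * (\<Prod>i = 2..k. zeta (p i) powi (\<epsilon> i * int (n i)))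
        = (\<Prod>i = 1..k. zeta (p i) powi (?\<delta> i * int (n i)))"
      unfolding split by simp
    also have "\<dots> = (\<Prod>i = 1..k. branch q ?\<delta> i ^ (2 * n i) / of_nat (p i ^ n i))"
      using that by (intro prod.cong factor) auto
    also have "\<dots> = branch_prod ?\<delta> / of_nat c"
      unfolding branch_prod_def assms(6) of_nat_prod by (rule prod_dividef)
    finally show ?thesis .
  qed
  have S: "S = (\<lambda>\<epsilon>. branch_prod \<epsilon> / of_nat c) ` E"
  proof (intro equalityI subsetI)
    fix \<zeta> assume "\<zeta> \<in> S"
    then obtain \<epsilon> where \<epsilon>: "\<forall>i \<in> {2..k}. \<epsilon> i \<in> {1, -1}"
      "\<zeta> = zeta (p 1) ^ n 1 * (\<Prod>i = 2..k. zeta (p i) powi (\<epsilon> i * int (n i)))"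
      unfolding S_def by blast
    then have "\<epsilon>(1 := 1) \<in> E" by (auto simp: E_def)
    then show "\<zeta> \<in> (\<lambda>\<epsilon>. branch_prod \<epsilon> / of_nat c) ` E"
      using elem[OF \<epsilon>(1)] \<epsilon>(2) by blast
  next
    fix \<zeta> assume "\<zeta> \<in> (\<lambda>\<epsilon>. branch_prod \<epsilon> / of_nat c) ` E"
    then obtain \<epsilon> where \<epsilon>: "\<epsilon> \<in> E" "\<zeta> = branch_prod \<epsilon> / of_nat c" by blast
    then have signs: "\<forall>i \<in> {2..k}. \<epsilon> i \<in> {1, -1}" and "\<epsilon>(1 := 1) = \<epsilon>" by (auto simp: E_def)
    then have "\<zeta> = zeta (p 1) ^ n 1 * (\<Prod>i = 2..k. zeta (p i) powi (\<epsilon> i * int (n i)))"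
      using elem[OF signs] \<epsilon>(2) by simp
    then show "\<zeta> \<in> S" unfolding S_def using signs by blast
  qed
  show "S \<subseteq> GQ - U" unfolding S using pt(1) by blast
  show "bij_betw pt S (PT c)"
    unfolding bij_betw_def
  proof (intro conjI inj_onI equalityI subsetI)
    fix \<zeta> \<zeta>' assume "\<zeta> \<in> S" "\<zeta>' \<in> S" and eq: "pt \<zeta> = pt \<zeta>'"
    from \<open>\<zeta> \<in> S\<close> obtain \<epsilon> where \<epsilon>: "\<epsilon> \<in> E" "\<zeta> = branch_prod \<epsilon> / of_nat c"
      unfolding S by (elim imageE)
    from \<open>\<zeta>' \<in> S\<close> obtain \<delta> where \<delta>: "\<delta> \<in> E" "\<zeta>' = branch_prod \<delta> / of_nat c"
      unfolding S by (elim imageE)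
    obtain a b where ab: "pt \<zeta> = (a, b, c)"
      "real a = min (abs (Re (branch_prod \<epsilon>))) (abs (Im (branch_prod \<epsilon>)))"
      "real b = max (abs (Re (branch_prod \<epsilon>))) (abs (Im (branch_prod \<epsilon>)))"
      using pt(2)[of \<epsilon>] unfolding \<epsilon>(2) by blast
    obtain a' b' where ab': "pt \<zeta>' = (a', b', c)"
      "real a' = min (abs (Re (branch_prod \<delta>))) (abs (Im (branch_prod \<delta>)))"
      "real b' = max (abs (Re (branch_prod \<delta>))) (abs (Im (branch_prod \<delta>)))"
      using pt(2)[of \<delta>] unfolding \<delta>(2) by blast
    have "a = a'" "b = b'" using eq unfolding ab(1) ab'(1) prod.inject by blast+
    then have "\<exists>u\<in>U. branch_prod \<epsilon> = u * branch_prod \<delta> \<or> branch_prod \<epsilon> = u * cnj (branch_prod \<delta>)"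
      using ab(2,3) ab'(2,3) by (intro unit_multiple_of_abs_eq) (simp_all only:)
    moreover have "cnj (branch_prod \<delta>) = branch_prod (\<lambda>i. - \<delta> i)"
      using cnj_branch_prod \<delta>(1) unfolding E_def by blast
    ultimately obtain u where u: "u \<in> U"
      "branch_prod \<epsilon> = u * branch_prod \<delta> \<or> branch_prod \<epsilon> = u * branch_prod (\<lambda>i. - \<delta> i)"
      by auto
    have 1: "1 \<in> {1..k}" using assms(2) by simp
    \<comment> \<open>Conjugation would flip the first sign, which is 1 for both
      \<open>\<epsilon>\<close> and \<open>\<delta>\<close>.\<close>
    have "branch_prod \<epsilon> \<noteq> u * branch_prod (\<lambda>i. - \<delta> i)"
    proof
      assume "branch_prod \<epsilon> = u * branch_prod (\<lambda>i. - \<delta> i)"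
      from branch_prod_unit_multiple[OF this u(1) 1] show False
        using \<epsilon>(1) \<delta>(1) by (simp add: E_def)
    qed
    with u(2) have "branch_prod \<epsilon> = u * branch_prod \<delta>" by blast
    then have "\<epsilon> i = 1 \<longleftrightarrow> \<delta> i = 1" if "i \<in> {1..k}" for i
      using branch_prod_unit_multiple u(1) that by blast
    \<comment> \<open>The products are compared and not the sign functions, which may differ outside
      \<open>{1..k}\<close>.\<close>
    then have "branch_prod \<epsilon> = branch_prod \<delta>"
      unfolding branch_prod_def by (intro prod.cong) (auto simp: branch_def)
    then show "\<zeta> = \<zeta>'" by (simp add: \<epsilon> \<delta>)
  next
    fix t assume "t \<in> pt ` S"
    then obtain \<epsilon> where "t = pt (branch_prod \<epsilon> / of_nat c)" unfolding S by blast
    with pt(2)[of \<epsilon>] show "t \<in> PT c" by metis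
  next
    fix t assume "t \<in> PT c"
    then obtain a b where t: "t = (a, b, c)" "(a, b, c) \<in> PT c" by (cases t) (auto simp: PT_iff)
    then have ab: "a\<^sup>2 + b\<^sup>2 = c\<^sup>2" "a \<le> b" "pythagorean_triple (a, b, c)" "normalized_triple (a, b, c)"
      unfolding PT_iff pythagorean_triple_def normalized_triple_def prod.case by blast+
    \<comment> \<open>Surjectivity: this primitive Gaussian integer has norm
      \<open>c\<^sup>2\<close>, so it factors into a unit and one branch per prime.\<close>
    define z where "z = Complex (of_int (int a)) (of_int (int b))"
    have "primitive z"
      using PT_coprime[OF t(2)] unfolding z_def primitive_Complex_iff by simp
    moreover have "(cmod z)\<^sup>2 = of_nat (\<Prod>i = 1..k. p i ^ (2 * n i))"
      unfolding c2 by (simp add: z_def cmod_power2 flip: ab(1))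
    ultimately obtain u \<epsilon> where u: "u \<in> U" "\<forall>i\<in>{1..k}. \<epsilon> i \<in> {1, -1}" "z = u * branch_prod \<epsilon>"
      using primitive_factorization[where p = p and q = q and e = "\<lambda>i. 2 * n i", OF finite q(1) neq_2]
      unfolding branch_prod_def by blast
    have 1: "1 \<in> {1..k}" using assms(2) by simp
    \<comment> \<open>If the first sign is -1, all signs are negated. This conjugates the product
      and leaves the sorted absolute coordinates, hence the triple, unchanged.\<close>
    obtain \<delta> where \<delta>: "\<delta> \<in> E" "branch_prod \<delta> = branch_prod \<epsilon> \<or> branch_prod \<delta> = cnj (branch_prod \<epsilon>)"
    proof (cases "\<epsilon> 1 = 1")
      case True
      then show thesis using that[of \<epsilon>] u(2) by (simp add: E_def)
    next
      case False
      then have "\<epsilon> 1 = -1" using u(2) 1 by blast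
      then show thesis
        using that[of "\<lambda>i. - \<epsilon> i"] u(2) cnj_branch_prod[OF u(2)] by (auto simp: E_def)
    qed
    obtain a' b' where pt': "pt (branch_prod \<delta> / of_nat c) = (a', b', c)"
      "real a' = min (abs (Re (branch_prod \<delta>))) (abs (Im (branch_prod \<delta>)))"
      "real b' = max (abs (Re (branch_prod \<delta>))) (abs (Im (branch_prod \<delta>)))"
      using pt(2)[of \<delta>] by blast
    have "real a = min (abs (Re z)) (abs (Im z))" "real b = max (abs (Re z)) (abs (Im z))"
      using ab(2) by (simp_all add: z_def)
    moreover have "min (abs (Re z)) (abs (Im z)) = real a'" "max (abs (Re z)) (abs (Im z)) = real b'"
      using abs_parts_unit_multiple[OF u(1), of "branch_prod \<epsilon>"] \<delta>(2) unfolding pt'(2,3)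
      by (auto simp only: u(3) cnj.simps abs_minus_cancel)
    ultimately have "a = a'" "b = b'" by (simp_all only: of_nat_eq_iff)
    then have "t = pt (branch_prod \<delta> / of_nat c)" unfolding t(1) pt'(1) by (simp only:)
    then show "t \<in> pt ` S" unfolding S using \<delta>(1) by blast
  qed
qed

end
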